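(* Let $\mathbf{c}\in\mathrm{SL}_\pm(n,\mathbb{R})$ and $\mathbf{t}\in\mathbb{R}^n$, and let $\mathbf{S}_{(\mathbf{c},\mathbf{t})}$ be the associated special affine shift operator on $\mathscr{H}=L^2(\mathbb{R}^n,da_1\cdots da_n)$. If $\mathbf{S}_{(\mathbf{c},\mathbf{t})}=c\cdot\mathrm{id}_{\mathscr{H}}$ for some complex scalar $c$, then $c=1$.
   Context: $\mathrm{SL}_\pm(n,\mathbb{R})=\{\mathbf{c}\in\mathrm{GL}(n,\mathbb{R}):|\det\mathbf{c}|=1\}$. Elements $\mathbf{a}=(a_1\ \cdots\ a_n)$ of $\mathbb{R}^n$ are written as row vectors. The special affine shift operator $\mathbf{S}_{(\mathbf{c},\mathbf{t})}$ is the unitary operator on $L^2(\mathbb{R}^n,da_1\cdots da_n)$ given by $(\mathbf{S}_{(\mathbf{c},\mathbf{t})}f)(\mathbf{a})=f(\mathbf{a}\,\mathbf{c}+\mathbf{t})$. *)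

theory Defs
  imports "HOL-Analysis.Analysis"
begin

definition square_integrable :: "('a::euclidean_space \<Rightarrow> complex) \<Rightarrow> bool" where
  "square_integrable f \<longleftrightarrow>
     f \<in> borel_measurable lborel \<and> integrable lborel (\<lambda>x. (cmod (f x))\<^sup>2)"

definition L2_eq :: "('a::euclidean_space \<Rightarrow> complex) \<Rightarrow> ('a \<Rightarrow> complex) \<Rightarrow> bool" where
  "L2_eq f g \<longleftrightarrow>
     square_integrable f \<and> square_integrable g \<and> (AE x in lborel. f x = g x)"

lemma L2_eq_part_equivp: "part_equivp (L2_eq :: ('a::euclidean_space \<Rightarrow> complex) \<Rightarrow> _)"
proof (rule part_equivpI)
  have "L2_eq (\<lambda>_. 0 :: complex) (\<lambda>_::'a. 0)"
    by (simp add: L2_eq_def square_integrable_def)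
  then show "\<exists>f :: 'a \<Rightarrow> complex. L2_eq f f" by blast
  show "symp (L2_eq :: ('a \<Rightarrow> complex) \<Rightarrow> _)"
    by (auto simp: symp_def L2_eq_def elim: AE_mp)
  show "transp (L2_eq :: ('a \<Rightarrow> complex) \<Rightarrow> _)"
  proof (rule transpI)
    fix f g h :: "'a \<Rightarrow> complex"
    assume fg: "L2_eq f g" and gh: "L2_eq g h"
    have "AE x in lborel. f x = g x" "AE x in lborel. g x = h x"
      using fg gh by (auto simp: L2_eq_def)
    then have "AE x in lborel. f x = h x" by eventually_elim simp
    with fg gh show "L2_eq f h" by (simp add: L2_eq_def)
  qed
qed

quotient_type (overloaded) 'a L2 = "'a::euclidean_space \<Rightarrow> complex" / partial: L2_eq
  by (rule L2_eq_part_equivp)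

lift_definition scale_L2 :: "complex \<Rightarrow> 'a::euclidean_space L2 \<Rightarrow> 'a L2"
  is "\<lambda>k f x. k * f x"
  by (auto simp: L2_eq_def square_integrable_def norm_mult power_mult_distrib)

definition SL_pm :: "(real ^ 'n ^ 'n) set" where
  "SL_pm = {c. invertible c \<and> \<bar>det c\<bar> = 1}"

text \<open>The row-vector action is \<open>a v* c\<close>. For \<open>c \<in> SL_pm\<close> the choice of representative
  \<open>rep_L2 f\<close> is immaterial; see \<open>special_affine_shift_abs_L2\<close> below.\<close>

definition special_affine_shift ::
    "real ^ 'n ^ 'n \<Rightarrow> real ^ 'n \<Rightarrow> (real ^ 'n) L2 \<Rightarrow> (real ^ 'n) L2" where
  "special_affine_shift c t f = abs_L2 (\<lambda>a. rep_L2 f (a v* c + t))"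

lemma measurable_affine_map [measurable]:
  fixes c :: "real ^ 'n ^ 'n" and t :: "real ^ 'n"
  shows "(\<lambda>a. a v* c + t) \<in> borel_measurable borel"
proof -
  have "(\<lambda>a. a v* c + t) = (\<lambda>a. transpose c *v a + t)" by simp
  moreover have "continuous_on UNIV (\<lambda>a. transpose c *v a + t)"
    by (intro continuous_intros)
  ultimately show ?thesis by (simp only: borel_measurable_continuous_onI)
qed

text \<open>The library's \<open>measure_linear_image\<close> requires a well-ordered index type; the next three
  lemmas give the nonsingular case over an arbitrary finite one.\<close>

lemma measure_elementary_shear:
  fixes m n :: "'n::finite" and S :: "(real ^ 'n) set"
  defines "h \<equiv> \<lambda>x. \<chi> i. if i = m then x $ m + x $ n else x $ i"
  assumes mn: "m \<noteq> n" and S: "S \<in> lmeasurable"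
  shows "h ` S \<in> lmeasurable \<and> measure lebesgue (h ` S) = \<bar>det (matrix h)\<bar> * measure lebesgue S"
proof -
  have lin: "linear h"
    by (rule linearI) (auto simp: h_def vec_eq_iff algebra_simps)
  have "matrix h = (\<chi> k. if k = m then row m (mat 1) + 1 *s row n (mat 1) else row k (mat 1))"
    using mn by (auto simp: h_def matrix_def row_def mat_def axis_def vec_eq_iff)
  then have det: "det (matrix h) = 1"
    using det_row_operation[OF mn, of "mat 1 :: real ^ 'n ^ 'n" 1] by simp
  have "measure lebesgue (h ` cbox a b) = 1 * measure lebesgue (cbox a b)" for a b
  proof (cases "cbox a b = {}")
    case False
    define v where "v = axis n (a $ n)"
    have ab: "cbox a b = (+) v ` cbox (a - v) (b - v)"
      using cbox_translation[of v "a - v" "b - v"] by simp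
    have "h ` cbox a b = (+) (h v) ` h ` cbox (a - v) (b - v)"
      unfolding ab by (simp add: image_image linear_add[OF lin])
    then have "measure lebesgue (h ` cbox a b) = measure lebesgue (h ` cbox (a - v) (b - v))"
      by (simp only: measure_translation)
    also have "\<dots> = measure lebesgue (cbox (a - v) (b - v))"
      unfolding h_def using False ab by (intro measure_shear_interval mn) (auto simp: v_def)
    also have "\<dots> = measure lebesgue (cbox a b)"
      unfolding ab by (simp only: measure_translation)
    finally show ?thesis by simp
  qed simp
  from measure_linear_sufficient[OF lin S this] det show ?thesis by simp
qed

lemma measure_elementary_swap:
  fixes m n :: "'n::finite" and S :: "(real ^ 'n) set"
  defines "h \<equiv> \<lambda>x. \<chi> i. x $ Transposition.transpose m n i"
  assumes S: "S \<in> lmeasurable"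
  shows "h ` S \<in> lmeasurable \<and> measure lebesgue (h ` S) = \<bar>det (matrix h)\<bar> * measure lebesgue S"
proof -
  have lin: "linear h"
    by (rule linearI) (auto simp: h_def vec_eq_iff algebra_simps)
  have hh: "h (h x) = x" for x by (simp add: h_def vec_eq_iff)
  have perm: "Transposition.transpose m n permutes (UNIV :: 'n set)"
    by (simp add: permutes_swap_id)
  have "matrix h = (\<chi> i. (mat 1 :: real ^ 'n ^ 'n) $ Transposition.transpose m n i)"
    by (simp add: h_def matrix_def mat_def axis_def vec_eq_iff)
  then have det: "\<bar>det (matrix h)\<bar> = 1"
    using det_permute_rows[OF perm, of "mat 1 :: real ^ 'n ^ 'n"]
    by (simp add: sign_def)
  have "measure lebesgue (h ` cbox a b) = 1 * measure lebesgue (cbox a b)" for a b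
  proof -
    have le: "x $ i \<le> y $ i" if "\<forall>j. h x $ j \<le> h y $ j" for x y :: "real ^ 'n" and i
      using that[rule_format, of "Transposition.transpose m n i"] by (simp add: h_def)
    have mem: "h x \<in> cbox (h u) (h w) \<longleftrightarrow> x \<in> cbox u w" for x u w
      unfolding mem_box_cart using le by (auto simp: h_def)
    have eq: "h ` cbox a b = cbox (h a) (h b)"
    proof (intro equalityI subsetI)
      fix y assume y: "y \<in> cbox (h a) (h b)"
      have "h y \<in> cbox a b" using y mem[of "h y" a b] by (simp only: hh)
      then have "h (h y) \<in> h ` cbox a b" by (rule imageI)
      then show "y \<in> h ` cbox a b" by (simp only: hh)
    qed (auto simp: mem)
    have "cbox (h a) (h b) = {} \<longleftrightarrow> cbox a b = {}" using eq by auto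
    moreover have "(\<Prod>i\<in>UNIV. h b $ i - h a $ i) = (\<Prod>i\<in>UNIV. b $ i - a $ i)"
      unfolding h_def using prod.permute[OF perm, of "\<lambda>i. b $ i - a $ i"] by (simp add: o_def)
    ultimately show ?thesis by (simp add: eq content_cbox_if_cart)
  qed
  from measure_linear_sufficient[OF lin S this] det show ?thesis by simp
qed

lemma measure_nonsingular_image:
  fixes f :: "real ^ 'n \<Rightarrow> real ^ 'n"
  assumes "linear f" "det (matrix f) \<noteq> 0" "S \<in> lmeasurable"
  shows "f ` S \<in> lmeasurable \<and> measure lebesgue (f ` S) = \<bar>det (matrix f)\<bar> * measure lebesgue S"
proof -
  let ?P = "\<lambda>f :: real ^ 'n \<Rightarrow> real ^ 'n. det (matrix f) \<noteq> 0 \<longrightarrow> (\<forall>S\<in>lmeasurable.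
      f ` S \<in> lmeasurable \<and> measure lebesgue (f ` S) = \<bar>det (matrix f)\<bar> * measure lebesgue S)"
  have "?P f"
    using \<open>linear f\<close>
  proof (rule induct_linear_elementary)
    fix f g :: "real ^ 'n \<Rightarrow> real ^ 'n"
    assume lin: "linear f" "linear g" and "?P f" "?P g"
    moreover have "(f \<circ> g) ` S = f ` g ` S" for S by (simp only: image_comp)
    ultimately show "?P (f \<circ> g)"
      by (simp only: matrix_compose[OF lin(2,1)] det_mul) (simp add: abs_mult)
  next
    fix f :: "real ^ 'n \<Rightarrow> real ^ 'n" and i
    assume lin: "linear f" and "\<And>x. f x $ i = 0"
    then have "\<not> surj f" by (metis one_neq_zero surjE vec_component)
    then have "\<not> inj f" using lin linear_injective_imp_surjective by blast
    then show "?P f" using det_nz_iff_inj[OF lin] by blast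
  next
    fix c :: "'n \<Rightarrow> real"
    have "matrix (\<lambda>x :: real ^ 'n. \<chi> i. c i * x $ i) = (\<chi> i j. if i = j then c i else 0)"
      by (simp add: matrix_def axis_def vec_eq_iff)
    then have "det (matrix (\<lambda>x :: real ^ 'n. \<chi> i. c i * x $ i)) = prod c UNIV"
      by (simp add: det_diagonal)
    then show "?P (\<lambda>x. \<chi> i. c i * x $ i)"
      using measurable_stretch measure_stretch by auto
  qed (intro impI ballI measure_elementary_swap measure_elementary_shear; assumption)+
  with assms show ?thesis by blast
qed

lemma distr_affine_map:
  fixes c :: "real ^ 'n ^ 'n" and t :: "real ^ 'n"
  assumes "c \<in> SL_pm"
  shows "distr lborel borel (\<lambda>a. a v* c + t) = lborel"
proof -
  have inv: "invertible c" and det: "\<bar>det c\<bar> = 1" using assms by (auto simp: SL_pm_def)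
  let ?d = "matrix_inv c"
  have cd: "c ** ?d = mat 1" "?d ** c = mat 1"
    using inv unfolding invertible_def matrix_inv_def
    by (metis (mono_tags, lifting) someI_ex)+
  have "det c * det ?d = 1" using det_mul[of c ?d] cd by simp
  then have det_d: "\<bar>det ?d\<bar> = 1" using det by (metis abs_mult abs_1 mult_1)
  have "lborel = distr lborel borel (\<lambda>a. a v* c)"
  proof (rule lborel_eqI)
    fix l u :: "real ^ 'n"
    assume lu: "\<And>b. b \<in> Basis \<Longrightarrow> l \<bullet> b \<le> u \<bullet> b"
    let ?f = "\<lambda>y. transpose ?d *v y"
    have lin: "linear ?f" by (rule matrix_vector_mul_linear)
    have pre: "(\<lambda>a. a v* c) -` box l u = ?f ` box l u"
    proof (intro equalityI subsetI)
      fix a assume "a \<in> (\<lambda>a. a v* c) -` box l u"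
      then have "a v* c \<in> box l u" by simp
      moreover have "a = ?f (a v* c)"
        by (simp add: vector_matrix_mul_assoc cd)
      ultimately show "a \<in> ?f ` box l u" by blast
    next
      fix a assume "a \<in> ?f ` box l u"
      then show "a \<in> (\<lambda>a. a v* c) -` box l u"
        by (auto simp: vector_matrix_mul_assoc cd)
    qed
    have box: "box l u \<in> lmeasurable" by simp
    have "\<bar>det (matrix ?f)\<bar> = 1" using det_d by (simp only: matrix_of_matrix_vector_mul det_transpose)
    then have img: "?f ` box l u \<in> lmeasurable"
      and m: "measure lebesgue (?f ` box l u) = measure lebesgue (box l u)"
      using measure_nonsingular_image[OF lin _ box] by auto
    have meas: "(\<lambda>a. a v* c) \<in> borel_measurable borel"
      using measurable_affine_map[of c 0] by simp
    have "(\<lambda>a. a v* c) -` box l u \<in> sets borel"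
      using measurable_sets_borel[OF meas, of "box l u"] by simp
    then have S: "?f ` box l u \<in> sets borel" by (simp only: pre)
    have "emeasure (distr lborel borel (\<lambda>a. a v* c)) (box l u) = emeasure lborel (?f ` box l u)"
      using meas by (simp add: emeasure_distr pre)
    also have "\<dots> = emeasure lebesgue (?f ` box l u)" using S by simp
    also have "\<dots> = ennreal (measure lebesgue (?f ` box l u))"
      using img by (simp add: emeasure_eq_measure2 fmeasurableD2)
    also have "\<dots> = emeasure lebesgue (box l u)"
      unfolding m using box by (simp add: emeasure_eq_measure2 fmeasurableD2)
    also have "\<dots> = ennreal (\<Prod>b\<in>Basis. (u - l) \<bullet> b)" using lu by simp
    finally show "emeasure (distr lborel borel (\<lambda>a. a v* c)) (box l u)
        = ennreal (\<Prod>b\<in>Basis. (u - l) \<bullet> b)" .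
  qed simp
  then have 1: "distr lborel borel (\<lambda>a. a v* c) = lborel" by simp
  have meas: "(\<lambda>a. a v* c) \<in> borel_measurable borel"
    using measurable_affine_map[of c 0] by simp
  have "distr lborel borel (\<lambda>a. a v* c + t)
      = distr (distr lborel borel (\<lambda>a. a v* c)) borel ((+) t)"
    using meas by (subst distr_distr) (auto simp: o_def add.commute)
  also have "\<dots> = lborel" unfolding 1 by (rule lborel_distr_plus)
  finally show ?thesis .
qed

lemma L2_eq_affine_map:
  fixes c :: "real ^ 'n ^ 'n" and t :: "real ^ 'n"
  assumes c: "c \<in> SL_pm" and fg: "L2_eq f g"
  shows "L2_eq (\<lambda>a. f (a v* c + t)) (\<lambda>a. g (a v* c + t))"
proof -
  have T: "(\<lambda>a. a v* c + t) \<in> measurable lborel borel" by simp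
  have sq: "square_integrable (\<lambda>a. h (a v* c + t))"
    if "square_integrable h" for h :: "real ^ 'n \<Rightarrow> complex"
  proof -
    have h: "h \<in> borel_measurable borel" "integrable lborel (\<lambda>x. (cmod (h x))\<^sup>2)"
      using that by (auto simp: square_integrable_def)
    have m: "(\<lambda>x. (cmod (h x))\<^sup>2) \<in> borel_measurable borel" using h(1) by measurable
    have "(\<lambda>a. h (a v* c + t)) \<in> borel_measurable lborel"
      using measurable_compose[OF T h(1)] .
    moreover have "integrable lborel (\<lambda>a. (cmod (h (a v* c + t)))\<^sup>2)"
      using integrable_distr_eq[OF T m] h(2) by (simp add: distr_affine_map[OF c])
    ultimately show ?thesis by (simp add: square_integrable_def)
  qed
  have [measurable]: "f \<in> borel_measurable borel" "g \<in> borel_measurable borel"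
    using fg by (auto simp: L2_eq_def square_integrable_def)
  have "{x \<in> space borel. f x = g x} \<in> sets borel" by measurable
  from AE_distr_iff[OF T this, unfolded distr_affine_map[OF c]] have "AE a in lborel. f (a v* c + t) = g (a v* c + t)"
    using fg by (simp add: L2_eq_def)
  with fg sq show ?thesis by (auto simp: L2_eq_def)
qed

lemma special_affine_shift_abs_L2:
  fixes c :: "real ^ 'n ^ 'n" and t :: "real ^ 'n"
  assumes c: "c \<in> SL_pm" and f: "square_integrable f"
  shows "special_affine_shift c t (abs_L2 f) = abs_L2 (\<lambda>a. f (a v* c + t))"
proof -
  have "L2_eq f f" using f by (simp add: L2_eq_def)
  then have "L2_eq (rep_L2 (abs_L2 f)) f"
    using Quotient_rep_abs[OF Quotient_L2] by blast
  from L2_eq_affine_map[OF c this] show ?thesis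
    unfolding special_affine_shift_def by (rule Quotient_rel_abs[OF Quotient_L2])
qed

end

theory Submission
  imports Defs
begin

text \<open>Affine maps with \<open>\<bar>det c\<bar> = 1\<close> preserve Lebesgue measure, so the shift operator
  preserves the integral of every function that is integrable as well as square integrable.
  If the operator is multiplication by \<open>k\<close>, then \<open>\<integral>f = k * \<integral>f\<close> for each such \<open>f\<close>. The indicator
  function of the unit cube has integral 1, which forces \<open>k = 1\<close>. Integrating, rather than
  comparing \<open>L2\<close> norms, is what yields \<open>k = 1\<close> instead of just \<open>\<bar>k\<bar> = 1\<close>.\<close>

lemma abs_L2_eq_imp_L2_eq:
  assumes "square_integrable f" "square_integrable g" "abs_L2 f = abs_L2 g"
  shows "L2_eq f g"
proof -
  have "L2_eq f f" "L2_eq g g"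
    using assms(1,2) by (simp_all add: L2_eq_def)
  with assms(3) show ?thesis
    using Quotient_rel[OF Quotient_L2, of f g] by blast
qed

text \<open>Equality of the two operators is an equality of classes; at a class with representative
  \<open>f\<close> it becomes the almost-everywhere identity on which one can integrate.\<close>

lemma special_affine_shift_eq_scale_AE:
  fixes c :: "real ^ 'n ^ 'n" and t :: "real ^ 'n"
  assumes c: "c \<in> SL_pm" and f: "square_integrable f"
    and eq: "special_affine_shift c t (abs_L2 f) = scale_L2 k (abs_L2 f)"
  shows "AE a in lborel. f (a v* c + t) = k * f a"
proof -
  have ff: "L2_eq f f" using f by (simp add: L2_eq_def)
  have "square_integrable (\<lambda>a. f (a v* c + t))"
    using L2_eq_affine_map[OF c ff] by (simp add: L2_eq_def)
  moreover have "square_integrable (\<lambda>a. k * f a)"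
    using f by (auto simp: square_integrable_def norm_mult power_mult_distrib)
  moreover have "abs_L2 (\<lambda>a. f (a v* c + t)) = abs_L2 (\<lambda>a. k * f a)"
    using eq special_affine_shift_abs_L2[OF c f] scale_L2.abs_eq[of f k] ff
    by (simp add: eq_onp_def)
  ultimately have "L2_eq (\<lambda>a. f (a v* c + t)) (\<lambda>a. k * f a)"
    by (rule abs_L2_eq_imp_L2_eq)
  then show ?thesis by (simp add: L2_eq_def)
qed

text \<open>The map pushes Lebesgue measure forward to itself, so this is a change of variables
  with unit Jacobian.\<close>

lemma integral_affine_map:
  fixes c :: "real ^ 'n ^ 'n" and t :: "real ^ 'n" and f :: "real ^ 'n \<Rightarrow> complex"
  assumes "c \<in> SL_pm" and f: "f \<in> borel_measurable borel"
  shows "(LINT a|lborel. f (a v* c + t)) = (LINT a|lborel. f a)"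
proof -
  have T: "(\<lambda>a. a v* c + t) \<in> measurable lborel borel" by simp
  show ?thesis
    using integral_distr[OF T f] by (simp add: distr_affine_map[OF assms(1)])
qed

theorem lemma98:
  fixes c :: "real ^ 'n ^ 'n" and t :: "real ^ 'n" and k :: complex
  assumes "c \<in> SL_pm"
    and "special_affine_shift c t = scale_L2 k \<circ> id"
  shows "k = 1"
proof -
  let ?Q = "cbox 0 One :: (real ^ 'n) set"
  define f :: "real ^ 'n \<Rightarrow> complex" where "f = (\<lambda>a. of_real (indicator ?Q a))"
  have f_meas: "f \<in> borel_measurable borel"
    unfolding f_def by measurable
  have "(\<lambda>a. (cmod (f a))\<^sup>2) = indicator ?Q"
    by (auto simp: f_def indicator_def)
  then have f_sq: "square_integrable f"
    using f_meas by (simp add: square_integrable_def emeasure_lborel_cbox_eq)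
  have f_int: "(LINT a|lborel. f a) = 1"
    by (simp add: f_def)
  have "AE a in lborel. f (a v* c + t) = k * f a"
    using assms(2) by (intro special_affine_shift_eq_scale_AE assms(1) f_sq) (simp add: fun_eq_iff)
  then have "(LINT a|lborel. f (a v* c + t)) = (LINT a|lborel. k * f a)"
    using f_meas measurable_compose[OF measurable_affine_map f_meas]
    by (intro integral_cong_AE) simp_all
  then show ?thesis
    using integral_affine_map[OF assms(1) f_meas] f_int by simp
qed

end
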